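(* ($(p,q)$-Ramanujan sum.) Let $0<q<p$, let $a,b,c,d,z$ be nonzero generic complex numbers (so that no factor occurring in a denominator below vanishes), and assume $$\left|\frac{ad}{bc}\right|<|z|<1.$$ Then $${}_1\Psi_1\big((a,b);(c,d);(p,q),z\big)=\frac{((p,q),(bc,ad),(c,bz),(pbz,qc);(p,q))_\infty}{((c,d),(pb,qa),(c,az),(pbz,pd);(p,q))_\infty}.$$
   Context: For $n\ge 0$, $((a,b);(p,q))_n=\prod_{i=0}^{n-1}(ap^i-bq^i)$ (equal to $1$ for $n=0$), and for $n\ge 1$, $$((a,b);(p,q))_{-n}=\frac{1}{((ap^{-n},bq^{-n});(p,q))_n}=\frac{1}{(ap^{-1}-bq^{-1})(ap^{-2}-bq^{-2})\cdots(ap^{-n}-bq^{-n})}.$$ Also $((a_1,b_1),\dots,(a_m,b_m);(p,q))_n=\prod_{j=1}^m((a_j,b_j);(p,q))_n$. The bilateral series is $${}_1\Psi_1((a,b);(c,d);(p,q),z)=\sum_{n=-\infty}^{\infty}\frac{((a,b);(p,q))_n}{((c,d);(p,q))_n}z^n.$$ A quotient of infinite products with the same number of pairs in numerator and denominator is understood as the limit as $N\to\infty$ of the same quotient with the subscript $\infty$ replaced by $N$.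
   Formalization: The printed range |ad/(bc)|<|z|<1 does not ensure convergence; the identity is proved there whenever the bilateral series converges (unconditionally), and proved together with convergence in the corrected range |ad/(bc)|<|az/c|<1. *)

theory Defs
  imports "HOL-Analysis.Analysis"
begin

text \<open>
  The \<open>(p,q)\<close>-shifted factorial \<open>((a,b);(p,q))\<^sub>n\<close> for integer \<open>n\<close>.
  For \<open>n < 0\<close> it is \<open>1 / ((a p\<^sup>n, b q\<^sup>n);(p,q))\<^sub>m\<close> with \<open>m = -n\<close>.
\<close>

definition pq_poch_nat :: "complex \<times> complex \<Rightarrow> real \<times> real \<Rightarrow> nat \<Rightarrow> complex" where
  "pq_poch_nat = (\<lambda>(a, b) (p, q) n.
     \<Prod>i<n. (a * of_real p ^ i - b * of_real q ^ i))"

definition pq_poch :: "complex \<times> complex \<Rightarrow> real \<times> real \<Rightarrow> int \<Rightarrow> complex" where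
  "pq_poch = (\<lambda>(a, b) (p, q) n.
     if n \<ge> 0 then pq_poch_nat (a, b) (p, q) (nat n)
     else 1 / pq_poch_nat (a * of_real p powi n, b * of_real q powi n) (p, q) (nat (- n)))"

definition pq_poch_list :: "(complex \<times> complex) list \<Rightarrow> real \<times> real \<Rightarrow> int \<Rightarrow> complex" where
  "pq_poch_list prs pq n = (\<Prod>ab\<leftarrow>prs. pq_poch ab pq n)"

definition psi11_term ::
  "complex \<times> complex \<Rightarrow> complex \<times> complex \<Rightarrow> real \<times> real \<Rightarrow> complex \<Rightarrow> int \<Rightarrow> complex" where
  "psi11_term ab cd pq z n = pq_poch ab pq n / pq_poch cd pq n * z powi n"

text \<open>
  Convergence of the bilateral series is unconditional (absolute) convergence over \<open>\<int>\<close>;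
  \<open>psi11\<close> is a meaningful value only where \<open>psi11_converges\<close> holds.
\<close>

definition psi11_converges ::
  "complex \<times> complex \<Rightarrow> complex \<times> complex \<Rightarrow> real \<times> real \<Rightarrow> complex \<Rightarrow> bool" where
  "psi11_converges ab cd pq z \<longleftrightarrow> psi11_term ab cd pq z summable_on UNIV"

definition psi11 ::
  "complex \<times> complex \<Rightarrow> complex \<times> complex \<Rightarrow> real \<times> real \<Rightarrow> complex \<Rightarrow> complex" where
  "psi11 ab cd pq z = (\<Sum>\<^sub>\<infinity>n\<in>UNIV. psi11_term ab cd pq z n)"

text \<open>
  A quotient of infinite products is the limit of the quotients of the truncated products;
  the individual infinite products need not converge.
\<close>

definition has_pq_inf_quotient ::
  "(complex \<times> complex) list \<Rightarrow> (complex \<times> complex) list \<Rightarrow> real \<times> real \<Rightarrow> complex \<Rightarrow> bool" where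
  "has_pq_inf_quotient nums dens pq R \<longleftrightarrow>
     (\<lambda>N. pq_poch_list nums pq (int N) / pq_poch_list dens pq (int N)) \<longlonglongrightarrow> R"

end

theory Submission
  imports Defs
begin

text \<open>
  Pulling \<open>a p\<^sup>i\<close> out of each factor \<open>a p\<^sup>i - b q\<^sup>i\<close> turns every \<open>(p,q)\<close>-object into its classical
  counterpart with base \<open>q/p\<close>, and the claim into Ramanujan's \<open>\<^sub>1\<psi>\<^sub>1\<close> sum with parameters
  \<open>A = b/a\<close>, \<open>x = d/c\<close> and argument \<open>Z = a z/c\<close>. From here on \<open>q\<close> denotes the classical base. Write
  \<open>F(x)\<close> for the sum over all integers \<open>n\<close> of \<open>(A;q)\<^sub>n (x q\<^sup>n;q)\<^sub>\<infinity> Z\<^sup>n\<close>, which is the \<open>\<^sub>1\<psi>\<^sub>1\<close> series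
  times \<open>(x;q)\<^sub>\<infinity>\<close>.

  Two functional equations determine \<open>F\<close>. The terms satisfy a contiguous relation
  (\<open>contiguous_term\<close>) which sums to \<open>(1 - x/(AZ)) F(x) = (1 - x/A) F(x q)\<close>. Iterating it and letting
  \<open>x q\<^sup>N\<close> tend to \<open>0\<close> under a bilateral majorant gives
  \<open>(x/(AZ);q)\<^sub>\<infinity> F(x) = (x/A;q)\<^sub>\<infinity> F(0)\<close> (\<open>sum_at_zero\<close>). The constant \<open>F(0)\<close> is found by taking \<open>x = q\<close>:
  then all terms of negative index vanish and \<open>F(q)\<close> is the one-sided series of the \<open>q\<close>-binomial
  theorem, evaluated by a second functional equation relating \<open>Z\<close> to \<open>q Z\<close> (\<open>q_binomial\<close>).

  Throughout, convergence enters only as summability of the series itself. In particular the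
  argument covers uniformly the series that terminate on one side, where analytic continuation from the
  annulus \<open>|x/A| < |Z| < 1\<close> might not be available because the annulus is empty. On the annulus,
  summability follows from the ratio test on each half of the integers.
\<close>


section \<open>Interchange of limits and bilateral sums\<close>

text \<open>
  Tannery's theorem over an arbitrary index set: the bound makes the finite partial sums converge
  uniformly in \<open>N\<close>, so the two limits may be exchanged.
\<close>

lemma tendsto_infsum_dominated:
  fixes f :: "nat \<Rightarrow> 'i \<Rightarrow> 'a::banach"
  assumes lim: "\<And>n. (\<lambda>N. f N n) \<longlonglongrightarrow> g n"
    and dom: "\<And>N n. N \<ge> M \<Longrightarrow> norm (f N n) \<le> D n"
    and D: "D summable_on I"
  shows "(\<lambda>N. infsum (f N) I) \<longlonglongrightarrow> infsum g I"
proof (rule swap_uniform_limit')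
  have g: "norm (g n) \<le> D n" for n
    by (rule LIMSEQ_le_const2[OF tendsto_norm[OF lim]]) (use dom in auto)
  have "(\<lambda>n. norm (g n)) summable_on I"
    by (rule Infinite_Sum.abs_summable_on_comparison_test'[OF D]) (use g in auto)
  then show "(sum g \<longlongrightarrow> infsum g I) (finite_subsets_at_top I)"
    by (rule infsum_tendsto[OF abs_summable_summable])
  show "uniform_limit {M..} (\<lambda>X N. \<Sum>n\<in>X. f N n) (\<lambda>N. infsum (f N) I)
      (finite_subsets_at_top I)"
    by (rule Weierstrass_m_test_general[OF _ D]) (use dom in auto)
  show "\<forall>\<^sub>F X in finite_subsets_at_top I. (\<lambda>N. \<Sum>n\<in>X. f N n) \<longlonglongrightarrow> sum g X"
    by (intro always_eventually allI tendsto_sum lim)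
qed (auto intro: eventually_ge_at_top)

lemma summable_on_int_halves:
  fixes f :: "int \<Rightarrow> 'a::banach"
  assumes "summable (\<lambda>m. norm (f (int m)))" and "summable (\<lambda>m. norm (f (- int m)))"
  shows "f summable_on UNIV"
proof -
  have 1: "f summable_on range int"
    using norm_summable_imp_summable_on[OF assms(1)]
    by (subst summable_on_reindex) (auto simp: o_def)
  have 2: "f summable_on range (\<lambda>m. - int m)"
    using norm_summable_imp_summable_on[OF assms(2)]
    by (subst summable_on_reindex) (auto simp: o_def inj_on_def)
  have 3: "range int \<union> range (\<lambda>m. - int m) = UNIV"
  proof (intro equalityI subsetI UnCI)
    fix n :: int
    assume "n \<notin> range (\<lambda>m. - int m)"
    then show "n \<in> range int" by (metis int_cases2 rangeI)
  qed auto
  have "f summable_on range int \<union> (range (\<lambda>m. - int m) - range int)"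
    by (intro summable_on_Un_disjoint 1 summable_on_subset_banach[OF 2]) auto
  then show ?thesis
    by (simp add: 3)
qed

lemma has_sum_minus:
  fixes f g :: "'i \<Rightarrow> 'a::real_normed_algebra_1"
  assumes "(f has_sum S) I" and "(g has_sum S') I"
  shows "((\<lambda>n. f n - g n) has_sum S - S') I"
  using has_sum_add[OF assms(1) has_sum_cmult_right[OF assms(2), of "- 1"]] by simp

lemma has_sum_int_shift:
  "((\<lambda>n. f (n + 1)) has_sum S) (UNIV :: int set) \<longleftrightarrow> (f has_sum S) UNIV"
  by (rule has_sum_reindex_bij_witness[where i = "\<lambda>n. n - 1" and j = "\<lambda>n. n + 1"]) auto

section \<open>The infinite shifted factorial\<close>

text \<open>
  The infinite shifted factorial \<open>(x;q)\<^sub>\<infinity>\<close>. It is polymorphic because the complex products are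
  majorized by real ones with base \<open>|q|\<close>.
\<close>

definition qinf :: "'a::{real_normed_field,banach} \<Rightarrow> 'a \<Rightarrow> 'a" where
  "qinf x q = (\<Prod>i. 1 - x * q ^ i)"

context
  fixes q :: "'a::{real_normed_field,banach}"
  assumes q: "norm q < 1"
begin

lemma qinf_convergent: "convergent_prod (\<lambda>i. 1 - x * q ^ i)"
proof (intro abs_convergent_prod_imp_convergent_prod summable_imp_abs_convergent_prod)
  show "summable (\<lambda>i. norm (1 - x * q ^ i - 1))"
    using q by (simp add: norm_mult norm_power summable_mult summable_geometric)
qed

lemma qinf_LIMSEQ: "(\<lambda>N. \<Prod>i<N. 1 - x * q ^ i) \<longlonglongrightarrow> qinf x q"
  unfolding qinf_def
  by (intro has_prod_imp_tendsto' convergent_prod_has_prod qinf_convergent)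

lemma qinf_step: "qinf x q = (1 - x) * qinf (x * q) q"
proof (rule LIMSEQ_unique)
  show "(\<lambda>N. \<Prod>i<Suc N. 1 - x * q ^ i) \<longlonglongrightarrow> qinf x q"
    by (rule LIMSEQ_Suc[OF qinf_LIMSEQ])
  have "(\<Prod>i<Suc N. 1 - x * q ^ i) = (1 - x) * (\<Prod>i<N. 1 - x * q * q ^ i)" for N
    unfolding prod.lessThan_Suc_shift by (simp add: mult.assoc)
  then show "(\<lambda>N. \<Prod>i<Suc N. 1 - x * q ^ i) \<longlonglongrightarrow> (1 - x) * qinf (x * q) q"
    by (simp only:) (intro tendsto_intros qinf_LIMSEQ)
qed

lemma qinf_nonzero: "(\<And>i. 1 - x * q ^ i \<noteq> 0) \<Longrightarrow> qinf x q \<noteq> 0"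
  unfolding qinf_def by (intro prodinf_nonzero qinf_convergent) auto

lemma qinf_eq_0:
  assumes "x * q ^ i = 1"
  shows "qinf x q = 0"
proof (rule LIMSEQ_unique[OF qinf_LIMSEQ])
  have "(\<Prod>i<N. 1 - x * q ^ i) = 0" if "N > i" for N
    using that assms by (intro prod_zero) (auto intro!: bexI[of _ i])
  then show "(\<lambda>N. \<Prod>i<N. 1 - x * q ^ i) \<longlonglongrightarrow> 0"
    by (intro tendsto_eventually eventually_mono[OF eventually_gt_at_top[of i]]) auto
qed

end

text \<open>
  Factorwise triangle inequality. The right-hand side is the product of the \<open>1 + t |q|\<^sup>i\<close>.
\<close>

lemma norm_qinf_le:
  fixes q :: "'a::{real_normed_field,banach}"
  assumes q: "norm q < 1" and "norm x \<le> t"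
  shows "norm (qinf x q) \<le> qinf (- t) (norm q)"
proof (rule LIMSEQ_le[OF tendsto_norm[OF qinf_LIMSEQ[OF q]] qinf_LIMSEQ])
  have "norm (1 - x * q ^ i) \<le> 1 - (- t) * norm q ^ i" for i
  proof -
    have "norm (1 - x * q ^ i) \<le> 1 + norm x * norm q ^ i"
      using norm_triangle_ineq4[of 1 "x * q ^ i"] by (simp add: norm_mult norm_power)
    also have "\<dots> \<le> 1 + t * norm q ^ i"
      using assms by (intro add_left_mono mult_right_mono) auto
    finally show ?thesis by simp
  qed
  then show "\<exists>N. \<forall>n\<ge>N. norm (\<Prod>i<n. 1 - x * q ^ i) \<le> (\<Prod>i<n. 1 - (- t) * norm q ^ i)"
    unfolding prod_norm[symmetric] by (intro exI allI impI prod_mono conjI) auto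
qed (use assms in auto)

lemma norm_qinf_minus_1_le:
  fixes q :: "'a::{real_normed_field,banach}"
  assumes q: "norm q < 1"
  shows "norm (qinf x q - 1) \<le> exp (norm x / (1 - norm q)) - 1"
proof (rule LIMSEQ_le_const2[OF tendsto_norm[OF tendsto_diff[OF qinf_LIMSEQ[OF q] tendsto_const]]])
  have "norm ((\<Prod>i<N. 1 - x * q ^ i) - 1) \<le> exp (norm x / (1 - norm q)) - 1" for N
  proof -
    have "norm ((\<Prod>i<N. 1 + - (x * q ^ i)) - 1) \<le> (\<Prod>i<N. 1 + norm (- (x * q ^ i))) - 1"
      by (rule norm_prod_minus1_le_prod_minus1)
    also have "(\<Prod>i<N. 1 + norm (- (x * q ^ i))) \<le> exp (\<Sum>i<N. norm (- (x * q ^ i)))"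
      by (rule prod_le_exp_sum) auto
    also have "(\<Sum>i<N. norm (- (x * q ^ i))) = norm x * (\<Sum>i<N. norm q ^ i)"
      by (simp add: norm_mult norm_power sum_distrib_left)
    also have "(\<Sum>i<N. norm q ^ i) \<le> 1 / (1 - norm q)"
      using sum_le_suminf[of "\<lambda>i. norm q ^ i" "{..<N}"] q
      by (simp add: summable_geometric suminf_geometric)
    finally show ?thesis by (simp add: mult_left_mono)
  qed
  then show "\<exists>N. \<forall>n\<ge>N. norm ((\<Prod>i<n. 1 - x * q ^ i) - 1) \<le> exp (norm x / (1 - norm q)) - 1"
    by blast
qed

lemma qinf_tendsto_1:
  fixes q :: "'a::{real_normed_field,banach}"
  assumes q: "norm q < 1" and y: "(y \<longlongrightarrow> 0) F"
  shows "((\<lambda>n. qinf (y n) q) \<longlongrightarrow> 1) F"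
proof -
  have "((\<lambda>n. exp (norm (y n) / (1 - norm q)) - 1) \<longlongrightarrow> exp (norm (0::'a) / (1 - norm q)) - 1) F"
    using q by (intro tendsto_intros y) auto
  then have "((\<lambda>n. qinf (y n) q - 1) \<longlongrightarrow> 0) F"
    by (intro Lim_null_comparison[OF always_eventually[OF allI[OF norm_qinf_minus_1_le[OF q]]]]) auto
  then show ?thesis
    by (simp add: LIM_zero_iff)
qed

section \<open>Bilateral basic hypergeometric sums\<close>

text \<open>
  The sequence \<open>u\<close> is \<open>n \<mapsto> (A;q)\<^sub>n\<close> on the integers, given by its recurrence and initial value. Running
  the recurrence downwards from \<open>u 0 = 1\<close> forces \<open>A \<noteq> q\<^sup>k\<close> for all \<open>k \<ge> 1\<close>, which is exactly the
  condition for \<open>(A;q)\<^sub>n\<close> to have no pole at negative \<open>n\<close>.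
\<close>

locale bilateral_factorial =
  fixes q A :: complex and u :: "int \<Rightarrow> complex"
  assumes q0: "q \<noteq> 0" and q1: "norm q < 1" and A0: "A \<noteq> 0"
    and u_0: "u 0 = 1" and u_Suc: "u (n + 1) = (1 - A * q powi n) * u n"
begin

lemma u_neg_nonzero: "u (- int m) \<noteq> 0"
proof (induction m)
  case (Suc m)
  have "u (- int m) = (1 - A * q powi (- int (Suc m))) * u (- int (Suc m))"
    using u_Suc[of "- int (Suc m)"] by simp
  with Suc show ?case by auto
qed (simp add: u_0)

lemma nonresonant: "1 - q / A * q ^ i \<noteq> 0"
proof
  assume "1 - q / A * q ^ i = 0"
  then have "A = q ^ Suc i" using A0 by (simp add: field_simps)
  then have "A * q powi (- int (Suc i)) = 1"
    using q0 by (simp only: power_int_minus power_int_of_nat) (simp del: power_Suc)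
  then show False
    using u_Suc[of "- int (Suc i)"] u_neg_nonzero[of i] by simp
qed

text \<open>
  Since \<open>1 / (x;q)\<^sub>n = (x q\<^sup>n;q)\<^sub>\<infinity> / (x;q)\<^sub>\<infinity>\<close>, this is the \<open>n\<close>-th term of the \<open>\<^sub>1\<psi>\<^sub>1\<close> series multiplied by the
  constant \<open>(x;q)\<^sub>\<infinity>\<close>. In this form there is no denominator in \<open>x\<close>, so the term makes sense at every \<open>x\<close>,
  and at \<open>x = 0\<close> it is \<open>(A;q)\<^sub>n Z\<^sup>n\<close>.
\<close>

definition reg_term :: "complex \<Rightarrow> complex \<Rightarrow> int \<Rightarrow> complex" where
  "reg_term Z x n = u n * qinf (x * q powi n) q * Z powi n"

text \<open>
  Both terms on the left are multiples of \<open>w = u\<^sub>n (x q\<^sup>n\<^sup>+\<^sup>1;q)\<^sub>\<infinity> Z\<^sup>n\<close>, which is the \<open>n\<close>-th term at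
  \<open>x q\<close>: the factors are \<open>1 - x q\<^sup>n\<close> and \<open>Z (1 - A q\<^sup>n)\<close>, and the coefficient \<open>x/(AZ)\<close> is chosen to
  cancel \<open>q\<^sup>n\<close>.
\<close>

lemma contiguous_term:
  assumes "Z \<noteq> 0"
  shows "reg_term Z x n - x / (A * Z) * reg_term Z x (n + 1) = (1 - x / A) * reg_term Z (x * q) n"
proof -
  have 1: "qinf (x * q powi n) q = (1 - x * q powi n) * qinf (x * q * q powi n) q"
    by (subst qinf_step[OF q1]) (simp add: mult_ac)
  have 2: "qinf (x * q powi (n + 1)) q = qinf (x * q * q powi n) q"
    using q0 by (simp add: power_int_add mult_ac)
  have 3: "Z powi (n + 1) = Z powi n * Z"
    using assms by (simp add: power_int_add)
  show ?thesis
    unfolding reg_term_def 1 2 3 u_Suc using assms A0 by (simp add: field_simps)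
qed

text \<open>
  The factor \<open>K\<close> is carried along because \<open>1 - x/A\<close> may be zero, in which case the series at \<open>x q\<close>
  could fail to be summable while its product with \<open>K (1 - x/A)\<close> is trivially summable.
\<close>

lemma contiguous_sum:
  assumes Z: "Z \<noteq> 0" and "((\<lambda>n. K * reg_term Z x n) has_sum S) UNIV"
  shows "((\<lambda>n. K * (1 - x / A) * reg_term Z (x * q) n) has_sum (1 - x / (A * Z)) * S) UNIV"
proof -
  have "((\<lambda>n. K * reg_term Z x (n + 1)) has_sum S) UNIV"
    using assms(2) has_sum_int_shift[of "\<lambda>n. K * reg_term Z x n" S] by simp
  from has_sum_add[OF assms(2) has_sum_cmult_right[OF this, of "- (x / (A * Z))"]]
  have "((\<lambda>n. K * (reg_term Z x n - x / (A * Z) * reg_term Z x (n + 1))) has_sum (1 - x / (A * Z)) * S) UNIV"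
    by (simp add: algebra_simps)
  then show ?thesis
    unfolding contiguous_term[OF Z] by (simp add: mult.assoc)
qed

lemma contiguous_sum_iterate:
  assumes Z: "Z \<noteq> 0" and "(reg_term Z x has_sum S) UNIV"
  shows "((\<lambda>n. (\<Prod>i<N. 1 - x / A * q ^ i) * reg_term Z (x * q ^ N) n)
    has_sum (\<Prod>i<N. 1 - x / (A * Z) * q ^ i) * S) UNIV"
proof (induction N)
  case (Suc N)
  from contiguous_sum[OF Z Suc] show ?case
    by (simp add: mult_ac)
qed (use assms in simp)

text \<open>
  The majorant dominates the terms at every \<open>x\<close> with \<open>|x| \<le> t\<close>. For \<open>n \<ge> 0\<close> the infinite product is bounded; in the
  negative direction the ratio of successive terms tends to \<open>t / |A Z|\<close>.
\<close>

lemma majorant_summable: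
  assumes Z: "Z \<noteq> 0" and t: "0 \<le> t" "t < norm (A * Z)"
    and s: "summable (\<lambda>n. norm (u (int n) * Z ^ n))"
  shows "(\<lambda>n. norm (u n) * qinf (- (t * norm q powi n)) (norm q) * norm Z powi n) summable_on UNIV"
    (is "?D summable_on _")
proof (rule summable_on_int_halves)
  have nq: "norm (norm q) < 1" using q1 by simp
  have \<Phi>: "norm (qinf (- y) (norm q)) \<le> qinf (- t) (norm q)" if "0 \<le> y" "y \<le> t" for y
    using norm_qinf_le[OF nq, of "- y" t] that by simp
  show "summable (\<lambda>m. norm (?D (int m)))"
  proof (rule summable_comparison_test'[OF summable_mult[OF s]])
    fix m
    have "norm (?D (int m)) = norm (u (int m) * Z ^ m) * norm (qinf (- (t * norm q ^ m)) (norm q))"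
      by (simp add: norm_mult norm_power abs_mult)
    also have "\<dots> \<le> norm (u (int m) * Z ^ m) * qinf (- t) (norm q)"
      using t q1 by (intro mult_left_mono \<Phi>) (auto intro!: mult_left_le power_le_one)
    finally show "norm (norm (?D (int m))) \<le> qinf (- t) (norm q) * norm (u (int m) * Z ^ m)"
      by (simp add: mult.commute)
  qed
  let ?\<rho> = "\<lambda>m. (norm q ^ Suc m + t) / (norm (q ^ Suc m - A) * norm Z)"
  have "?\<rho> \<longlonglongrightarrow> (0 + t) / (norm (0 - A) * norm Z)"
    by (intro tendsto_intros filterlim_compose[OF LIMSEQ_power_zero filterlim_Suc] nq q1)
       (use A0 Z in auto)
  moreover have "(0 + t) / (norm (0 - A) * norm Z) < 1"
    using t A0 Z by (simp add: norm_mult)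
  ultimately obtain c where c: "c < 1" and "\<forall>\<^sub>F m in sequentially. ?\<rho> m < c"
    using dense[of "(0 + t) / (norm (0 - A) * norm Z)" 1] order_tendstoD(2)[of ?\<rho>] by blast
  then obtain N where N: "\<And>m. m \<ge> N \<Longrightarrow> ?\<rho> m < c"
    by (auto simp: eventually_sequentially)
  show "summable (\<lambda>m. norm (?D (- int m)))"
  proof (rule summable_ratio_test[OF c])
    fix m assume m: "m \<ge> N"
    let ?k = "- int (Suc m)"
    have k: "?k + 1 = - int m" by simp
    have u: "u (- int m) = (1 - A * q powi ?k) * u ?k"
      using u_Suc[of ?k] unfolding k .
    have nz: "1 - A * q powi ?k \<noteq> 0"
      using u_neg_nonzero[of m] unfolding u by auto
    have Q: "qinf (- (t * norm q powi ?k)) (norm q)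
        = (1 + t * norm q powi ?k) * qinf (- (t * norm q powi (- int m))) (norm q)"
    proof -
      have "norm q powi ?k * norm q = norm q powi (- int m)"
        using q0 unfolding k[symmetric] by (subst power_int_add) auto
      then show ?thesis
        by (subst qinf_step[OF nq]) (simp only: minus_mult_left [symmetric] mult.assoc diff_minus_eq_add)
    qed
    have P: "norm Z powi (- int m) = norm Z powi ?k * norm Z"
      using Z unfolding k[symmetric] by (subst power_int_add) auto
    have pos: "q ^ Suc m - A \<noteq> 0"
    proof
      assume "q ^ Suc m - A = 0"
      then have "A * q powi ?k = 1"
        unfolding power_int_minus power_int_of_nat using A0 by (simp del: power_Suc)
      with nz show False by simp
    qed
    have R: "(1 + t * norm q powi ?k) = ?\<rho> m * (norm (1 - A * q powi ?k) * norm Z)"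
    proof -
      have "1 - A * q powi ?k = (q ^ Suc m - A) / q ^ Suc m"
        using q0 unfolding power_int_minus power_int_of_nat by (simp add: field_simps)
      then have 1: "norm (1 - A * q powi ?k) = norm (q ^ Suc m - A) / norm q ^ Suc m"
        by (simp only: norm_divide norm_power)
      have 2: "norm q powi ?k = 1 / norm q ^ Suc m"
        by (simp only: power_int_minus power_int_of_nat inverse_eq_divide)
      show ?thesis
        unfolding 1 2 using pos Z q0 by (simp add: field_simps del: power_Suc)
    qed
    have "?D ?k = ?\<rho> m * ?D (- int m)"
      unfolding Q P u R norm_mult by (simp only: mult_ac)
    then have "norm (?D ?k) = ?\<rho> m * norm (?D (- int m))"
      using t by (simp only: norm_mult) (simp del: power_Suc)
    also have "\<dots> \<le> c * norm (?D (- int m))"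
      using N[OF m] by (intro mult_right_mono) auto
    finally show "norm (norm (?D ?k)) \<le> c * norm (norm (?D (- int m)))"
      by simp
  qed
qed

lemma norm_reg_term_le:
  assumes "norm x \<le> t"
  shows "norm (reg_term Z x n) \<le> norm (u n) * qinf (- (t * norm q powi n)) (norm q) * norm Z powi n"
proof -
  have "norm (x * q powi n) \<le> t * norm q powi n"
    using assms by (simp add: norm_mult norm_power_int mult_right_mono)
  from norm_qinf_le[OF q1 this] show ?thesis
    by (auto simp: reg_term_def norm_mult norm_power_int intro!: mult_right_mono mult_left_mono)
qed

lemma reg_term_summable:
  assumes "Z \<noteq> 0" and "norm x < norm (A * Z)"
    and "summable (\<lambda>n. norm (u (int n) * Z ^ n))"
  shows "reg_term Z x summable_on UNIV"
  using abs_summable_summable[OF Infinite_Sum.abs_summable_on_comparison_test'[OF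
    majorant_summable[OF assms(1) norm_ge_zero assms(2,3)] norm_reg_term_le[OF order_refl]]] .

text \<open>
  The iterated contiguous relation in the limit. The majorant applies only from some \<open>M\<close> on, when
  \<open>|x q\<^sup>M| < |A Z|\<close>, which suffices for the limit.
\<close>

lemma sum_at_zero:
  assumes Z: "Z \<noteq> 0" and S: "(reg_term Z x has_sum S) UNIV"
    and s: "summable (\<lambda>n. norm (u (int n) * Z ^ n))"
  shows "qinf (x / (A * Z)) q * S = qinf (x / A) q * (\<Sum>\<^sub>\<infinity>n. u n * Z powi n)"
proof -
  let ?K = "\<lambda>N. \<Prod>i<N. 1 - x / A * q ^ i"
  have qN: "(\<lambda>N. q ^ N) \<longlonglongrightarrow> 0"
    by (rule LIMSEQ_power_zero[OF q1])
  have "(\<lambda>N. norm x * norm q ^ N) \<longlonglongrightarrow> norm x * 0"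
    using q1 by (intro tendsto_intros LIMSEQ_power_zero) auto
  moreover have "norm x * 0 < norm (A * Z)" using A0 Z by simp
  ultimately have "\<forall>\<^sub>F N in sequentially. norm x * norm q ^ N < norm (A * Z)"
    by (rule order_tendstoD(2))
  then obtain M where M: "norm x * norm q ^ M < norm (A * Z)"
    by (auto simp: eventually_sequentially)
  define t where "t = norm x * norm q ^ M"
  let ?D = "\<lambda>n. norm (u n) * qinf (- (t * norm q powi n)) (norm q) * norm Z powi n"
  have D: "?D summable_on UNIV"
    using M by (intro majorant_summable[OF Z _ _ s]) (auto simp: t_def)
  have "(\<lambda>N. infsum (reg_term Z (x * q ^ N)) UNIV) \<longlonglongrightarrow> (\<Sum>\<^sub>\<infinity>n. u n * Z powi n)"
  proof (rule tendsto_infsum_dominated[OF _ _ D])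
    fix n
    have "(\<lambda>N. x * q ^ N * q powi n) \<longlonglongrightarrow> x * 0 * q powi n"
      by (intro tendsto_intros qN)
    then have "(\<lambda>N. qinf (x * q ^ N * q powi n) q) \<longlonglongrightarrow> 1"
      by (intro qinf_tendsto_1[OF q1]) simp
    then have "(\<lambda>N. u n * qinf (x * q ^ N * q powi n) q * Z powi n) \<longlonglongrightarrow> u n * 1 * Z powi n"
      by (intro tendsto_intros)
    then show "(\<lambda>N. reg_term Z (x * q ^ N) n) \<longlonglongrightarrow> u n * Z powi n"
      by (simp add: reg_term_def)
  next
    fix N n assume "M \<le> N"
    then have "norm (x * q ^ N) \<le> t"
      using q1 by (auto simp: t_def norm_mult norm_power intro!: mult_left_mono power_decreasing)
    then show "norm (reg_term Z (x * q ^ N) n) \<le> ?D n" by (rule norm_reg_term_le)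
  qed
  then have "(\<lambda>N. ?K N * infsum (reg_term Z (x * q ^ N)) UNIV)
      \<longlonglongrightarrow> qinf (x / A) q * (\<Sum>\<^sub>\<infinity>n. u n * Z powi n)"
    by (intro tendsto_mult qinf_LIMSEQ[OF q1])
  moreover have K: "?K N * infsum (reg_term Z (x * q ^ N)) UNIV = (\<Prod>i<N. 1 - x / (A * Z) * q ^ i) * S" for N
    using infsumI[OF contiguous_sum_iterate[OF Z S, of N]] by (simp add: infsum_cmult_right')
  ultimately have "(\<lambda>N. (\<Prod>i<N. 1 - x / (A * Z) * q ^ i) * S)
      \<longlonglongrightarrow> qinf (x / A) q * (\<Sum>\<^sub>\<infinity>n. u n * Z powi n)"
    by (simp only: K)
  moreover have "(\<lambda>N. (\<Prod>i<N. 1 - x / (A * Z) * q ^ i) * S) \<longlonglongrightarrow> qinf (x / (A * Z)) q * S"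
    by (intro tendsto_intros qinf_LIMSEQ[OF q1])
  ultimately show ?thesis by (rule LIMSEQ_unique[rotated])
qed

text \<open>
  For \<open>n < 0\<close> the product \<open>(q\<^sup>n\<^sup>+\<^sup>1;q)\<^sub>\<infinity>\<close> contains the factor \<open>1 - q\<^sup>0\<close>.
\<close>

lemma reg_term_q_neg:
  assumes "n < 0"
  shows "reg_term Z q n = 0"
proof -
  have "q * q powi n * q ^ nat (- n - 1) = q powi (1 + n + int (nat (- n - 1)))"
    unfolding power_int_add[OF disjI1[OF q0]] power_int_of_nat power_int_1_right ..
  also have "1 + n + int (nat (- n - 1)) = 0" using assms by simp
  finally have "q * q powi n * q ^ nat (- n - 1) = 1" by simp
  then show ?thesis by (simp add: reg_term_def qinf_eq_0[OF q1])
qed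

lemma reg_term_q_summable:
  assumes s: "summable (\<lambda>n. norm (u (int n) * Z ^ n))"
  shows "reg_term Z q summable_on UNIV"
proof (rule summable_on_int_halves)
  show "summable (\<lambda>m. norm (reg_term Z q (int m)))"
  proof (rule summable_comparison_test'[OF summable_mult[OF s]])
    fix m
    have *: "norm (q * q powi int m) \<le> 1"
      using power_le_one[of "norm q" "Suc m"] q1 by (simp add: norm_mult norm_power)
    have "norm (reg_term Z q (int m)) = norm (u (int m) * Z ^ m) * norm (qinf (q * q powi int m) q)"
      unfolding reg_term_def norm_mult power_int_of_nat by (simp only: mult_ac)
    also have "\<dots> \<le> norm (u (int m) * Z ^ m) * qinf (- 1) (norm q)"
      by (rule mult_left_mono[OF norm_qinf_le[OF q1 *] norm_ge_zero])
    finally show "norm (norm (reg_term Z q (int m))) \<le> qinf (- 1) (norm q) * norm (u (int m) * Z ^ m)"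
      by (simp only: real_norm_def abs_norm_cancel mult.commute)
  qed
  have "(\<lambda>m. norm (reg_term Z q (- int m))) = (\<lambda>m. if m = 0 then norm (reg_term Z q 0) else 0)"
    by (auto simp: reg_term_q_neg)
  then show "summable (\<lambda>m. norm (reg_term Z q (- int m)))"
    by (simp only:) (rule summable_single)
qed

text \<open>
  The \<open>q\<close>-binomial theorem, multiplied by \<open>(q;q)\<^sub>\<infinity>\<close>. Let \<open>G(Z)\<close> be the sum. The first-order recurrence of the
  terms gives \<open>(1 - Z) G(Z) = (1 - A Z) G(q Z)\<close>, and \<open>G(q\<^sup>N Z)\<close> tends to the constant term
  \<open>(q;q)\<^sub>\<infinity>\<close>.
\<close>

lemma q_binomial:
  assumes Z: "Z \<noteq> 0" and S: "(reg_term Z q has_sum S) UNIV"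
  shows "qinf Z q * S = qinf (A * Z) q * qinf q q"
proof -
  define X where "X N n = reg_term Z q n * (q ^ N) powi n" for N n
  define G where "G N = infsum (X N) UNIV" for N
  have D: "(\<lambda>n. norm (reg_term Z q n)) summable_on UNIV"
    using S has_sum_imp_summable summable_on_iff_abs_summable_on_complex by blast
  have le: "norm (X N n) \<le> norm (reg_term Z q n)" for N n
  proof (cases "n < 0")
    case False
    then have "norm ((q ^ N) powi n) \<le> 1"
      using q1 by (simp add: norm_power_int norm_power power_int_nonneg_exp power_le_one)
    then show ?thesis by (simp add: X_def norm_mult mult_left_le)
  qed (simp add: X_def reg_term_q_neg)
  have X: "(X N has_sum G N) UNIV" for N
    unfolding G_def
    by (rule has_sum_infsum[OF abs_summable_summable[OF Infinite_Sum.abs_summable_on_comparison_test'[OF D le]]])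
  have step: "(1 - Z * q ^ N) * G N = (1 - A * Z * q ^ N) * G (Suc N)" for N
  proof -
    have W_Suc: "(1 - q powi (n + 1)) * reg_term Z q (n + 1) = Z * (1 - A * q powi n) * reg_term Z q n" for n
    proof -
      have 1: "qinf (q * q powi n) q = (1 - q powi (n + 1)) * qinf (q * q powi (n + 1)) q"
        using q0 by (subst qinf_step[OF q1]) (simp add: power_int_add mult_ac)
      have 3: "Z powi (n + 1) = Z powi n * Z"
        using Z by (simp add: power_int_add)
      show ?thesis unfolding reg_term_def 1 3 u_Suc by (simp add: mult_ac)
    qed
    have X_Suc: "X (Suc N) n = q powi n * X N n" for n
      by (simp add: X_def power_int_mult_distrib mult_ac)
    have rec: "X N (n + 1) - X (Suc N) (n + 1) = Z * q ^ N * X N n - A * Z * q ^ N * X (Suc N) n" for n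
    proof -
      have "X N (n + 1) - X (Suc N) (n + 1)
          = (1 - q powi (n + 1)) * reg_term Z q (n + 1) * (q ^ N) powi (n + 1)"
        unfolding X_Suc by (simp add: X_def algebra_simps)
      also have "\<dots> = Z * (1 - A * q powi n) * reg_term Z q n * ((q ^ N) powi n * q ^ N)"
        unfolding W_Suc using q0 by (simp add: power_int_add)
      also have "\<dots> = Z * q ^ N * X N n - A * Z * q ^ N * X (Suc N) n"
        unfolding X_Suc by (simp add: X_def algebra_simps)
      finally show ?thesis .
    qed
    have "((\<lambda>n. X N n - X (Suc N) n) has_sum G N - G (Suc N)) UNIV"
      by (intro has_sum_minus X)
    then have "((\<lambda>n. Z * q ^ N * X N n - A * Z * q ^ N * X (Suc N) n) has_sum G N - G (Suc N)) UNIV"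
      unfolding rec[symmetric] by (subst has_sum_int_shift)
    moreover have "((\<lambda>n. Z * q ^ N * X N n - A * Z * q ^ N * X (Suc N) n)
        has_sum Z * q ^ N * G N - A * Z * q ^ N * G (Suc N)) UNIV"
      by (intro has_sum_minus has_sum_cmult_right X)
    ultimately have "G N - G (Suc N) = Z * q ^ N * G N - A * Z * q ^ N * G (Suc N)"
      by (rule has_sum_unique)
    then show ?thesis by (simp add: algebra_simps)
  qed
  have G0: "G 0 = S"
    using S by (simp add: G_def X_def[abs_def] infsumI)
  have prods: "(\<Prod>i<N. 1 - Z * q ^ i) * S = (\<Prod>i<N. 1 - A * Z * q ^ i) * G N" for N
  proof (induction N)
    case (Suc N)
    have "(\<Prod>i<Suc N. 1 - Z * q ^ i) * S = (\<Prod>i<N. 1 - A * Z * q ^ i) * ((1 - Z * q ^ N) * G N)"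
      using Suc by (simp add: mult_ac)
    then show ?case unfolding step by (simp add: mult_ac)
  qed (simp add: G0)
  have "(\<lambda>N. infsum (X N) UNIV) \<longlonglongrightarrow> infsum (\<lambda>n::int. if n = 0 then qinf q q else 0) UNIV"
  proof (rule tendsto_infsum_dominated[where M = 0, OF _ _ D])
    fix n :: int
    consider "n < 0" | "n = 0" | "n > 0" by linarith
    then show "(\<lambda>N. X N n) \<longlonglongrightarrow> (if n = 0 then qinf q q else 0)"
    proof cases
      case 3
      then have "norm (q powi n) < 1"
        using q1 power_strict_decreasing[of 0 "nat n" "norm q"] q0
        by (simp add: power_int_nonneg_exp norm_power)
      then have "(\<lambda>N. reg_term Z q n * (q powi n) ^ N) \<longlonglongrightarrow> reg_term Z q n * 0"
        by (intro tendsto_intros LIMSEQ_power_zero)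
      then show ?thesis
        using 3 by (simp add: X_def power_int_power power_int_power' mult.commute)
    qed (simp_all add: X_def reg_term_q_neg, simp add: reg_term_def u_0)
  qed (rule le)
  also have "infsum (\<lambda>n::int. if n = 0 then qinf q q else 0) UNIV = qinf q q"
    by (intro infsumI has_sum_finite_neutralI[of "{0}"]) auto
  finally have "G \<longlonglongrightarrow> qinf q q" by (simp add: G_def[abs_def])
  then have "(\<lambda>N. (\<Prod>i<N. 1 - A * Z * q ^ i) * G N) \<longlonglongrightarrow> qinf (A * Z) q * qinf q q"
    by (intro tendsto_mult qinf_LIMSEQ[OF q1])
  moreover have "(\<lambda>N. (\<Prod>i<N. 1 - Z * q ^ i) * S) \<longlonglongrightarrow> qinf Z q * S"
    by (intro tendsto_intros qinf_LIMSEQ[OF q1])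
  ultimately show ?thesis
    unfolding prods by (rule LIMSEQ_unique[rotated])
qed

text \<open>
  On the nonnegative half, \<open>(x q\<^sup>n;q)\<^sub>\<infinity> \<rightarrow> 1\<close>, so the terms at \<open>x\<close> and at \<open>0\<close> are comparable.
\<close>

lemma nonneg_half_summable:
  assumes "reg_term Z x summable_on UNIV"
  shows "summable (\<lambda>n. norm (u (int n) * Z ^ n))"
proof -
  have "(\<lambda>n. norm (reg_term Z x n)) summable_on range int"
    using assms summable_on_iff_abs_summable_on_complex summable_on_subset_banach subset_UNIV
    by metis
  then have "summable (\<lambda>n. norm (reg_term Z x (int n)))"
    by (subst (asm) summable_on_reindex) (auto simp: o_def intro: summable_on_imp_summable)
  then have s: "summable (\<lambda>n. 2 * norm (reg_term Z x (int n)))"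
    by (rule summable_mult)
  have "(\<lambda>n. x * q ^ n) \<longlonglongrightarrow> x * 0"
    by (intro tendsto_intros LIMSEQ_power_zero q1)
  then have "(\<lambda>n. norm (qinf (x * q ^ n) q)) \<longlonglongrightarrow> norm (1::complex)"
    by (intro tendsto_norm qinf_tendsto_1[OF q1]) simp
  then have "\<forall>\<^sub>F n in sequentially. 1 / 2 < norm (qinf (x * q ^ n) q)"
    by (rule order_tendstoD) simp
  then have "\<forall>\<^sub>F n in sequentially. norm (norm (u (int n) * Z ^ n)) \<le> 2 * norm (reg_term Z x (int n))"
  proof eventually_elim
    case (elim n)
    have "norm (u (int n) * Z ^ n) * 1 \<le> norm (u (int n) * Z ^ n) * (2 * norm (qinf (x * q ^ n) q))"
      using elim by (intro mult_left_mono) auto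
    then show ?case by (simp add: reg_term_def norm_mult mult_ac)
  qed
  from summable_comparison_test_ev[OF this s] show ?thesis .
qed

lemma geometric_summable:
  assumes "norm Z < 1"
  shows "summable (\<lambda>n. norm (u (int n) * Z ^ n))"
proof -
  have "(\<lambda>n. norm (1 - A * q ^ n) * norm Z) \<longlonglongrightarrow> norm (1 - A * 0) * norm Z"
    by (intro tendsto_intros LIMSEQ_power_zero q1)
  moreover obtain c where c: "norm (1 - A * 0) * norm Z < c" "c < 1"
    using dense[of "norm Z" 1] assms by auto
  ultimately have "\<forall>\<^sub>F n in sequentially. norm (1 - A * q ^ n) * norm Z < c"
    using order_tendstoD(2) by blast
  then obtain N where N: "\<And>n. n \<ge> N \<Longrightarrow> norm (1 - A * q ^ n) * norm Z < c"
    by (auto simp: eventually_sequentially)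
  show ?thesis
  proof (rule summable_ratio_test[OF c(2)])
    fix n assume "n \<ge> N"
    have "u (int (Suc n)) = (1 - A * q ^ n) * u (int n)"
      using u_Suc[of "int n"] by (simp add: add.commute)
    then have "norm (u (int (Suc n)) * Z ^ Suc n)
        = (norm (1 - A * q ^ n) * norm Z) * norm (u (int n) * Z ^ n)"
      by (simp add: norm_mult norm_power)
    also have "\<dots> \<le> c * norm (u (int n) * Z ^ n)"
      using N[OF \<open>n \<ge> N\<close>] by (intro mult_right_mono) auto
    finally show "norm (norm (u (int (Suc n)) * Z ^ Suc n)) \<le> c * norm (norm (u (int n) * Z ^ n))"
      by simp
  qed
qed

text \<open>
  The value at \<open>0\<close> is eliminated between the relation for \<open>x\<close> and the one for \<open>q\<close>. Stating the result
  without dividing by infinite products keeps it valid when some of them vanish, for instance at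
  \<open>Z = q\<^sup>-\<^sup>i\<close>, where a series that terminates to the right may still be summable.
\<close>

theorem ramanujan_psi_sum:
  assumes Z: "Z \<noteq> 0" and S: "(reg_term Z x has_sum S) UNIV"
  shows "qinf (x / (A * Z)) q * qinf (q / A) q * qinf Z q * S
    = qinf q q * qinf (x / A) q * qinf (A * Z) q * qinf (q / (A * Z)) q"
proof -
  let ?S0 = "\<Sum>\<^sub>\<infinity>n. u n * Z powi n"
  have s: "summable (\<lambda>n. norm (u (int n) * Z ^ n))"
    using nonneg_half_summable has_sum_imp_summable[OF S] .
  obtain S1 where S1: "(reg_term Z q has_sum S1) UNIV"
    using reg_term_q_summable[OF s] by (auto simp: summable_on_def)
  note 1 = sum_at_zero[OF Z S s] and 2 = sum_at_zero[OF Z S1 s] and 3 = q_binomial[OF Z S1]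
  have "qinf (x / (A * Z)) q * qinf (q / A) q * qinf Z q * S
      = qinf (q / A) q * qinf Z q * (qinf (x / (A * Z)) q * S)" by (simp only: mult_ac)
  also have "\<dots> = qinf (x / A) q * qinf Z q * (qinf (q / A) q * ?S0)"
    unfolding 1 by (simp only: mult_ac)
  also have "\<dots> = qinf (x / A) q * qinf (q / (A * Z)) q * (qinf Z q * S1)"
    unfolding 2[symmetric] by (simp only: mult_ac)
  also have "\<dots> = qinf q q * qinf (x / A) q * qinf (A * Z) q * qinf (q / (A * Z)) q"
    unfolding 3 by (simp only: mult_ac)
  finally show ?thesis .
qed

end

section \<open>Passage from base \<open>q/p\<close> to the \<open>(p,q)\<close>-shifted factorials\<close>

lemma pq_poch_of_nat:
  "pq_poch (a, b) (p, q) (int N) = (\<Prod>i<N. a * of_real p ^ i - b * of_real q ^ i)"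
  by (simp add: pq_poch_def pq_poch_nat_def)

lemma pq_poch_Suc:
  assumes "n \<ge> 0"
  shows "pq_poch (a, b) (p, q) (n + 1)
    = (a * of_real p powi n - b * of_real q powi n) * pq_poch (a, b) (p, q) n"
proof -
  obtain m where n: "n = int m" using assms nonneg_int_cases by blast
  have "n + 1 = int (Suc m)" using n by simp
  then show ?thesis
    unfolding n by (simp only: pq_poch_of_nat prod.lessThan_Suc power_int_of_nat mult.commute)
qed

text \<open>
  Since \<open>1/0 = 0\<close>, the step down from \<open>n + 1\<close> to \<open>n\<close> holds even when the factor vanishes: then both sides
  are \<open>0\<close>.
\<close>

lemma pq_poch_pred:
  assumes "n < 0" and pq: "p \<noteq> 0" "q \<noteq> 0"
  shows "pq_poch (a, b) (p, q) n
    = pq_poch (a, b) (p, q) (n + 1) / (a * of_real p powi n - b * of_real q powi n)"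
proof -
  define k where "k = nat (- (n + 1))"
  have k: "nat (- n) = Suc k" using assms by (simp add: k_def)
  have pow: "of_real y powi (n + 1) = of_real y powi n * (of_real y :: complex)" if "y \<noteq> 0" for y
    using that by (simp add: power_int_add)
  have rest: "pq_poch (a, b) (p, q) (n + 1) =
      1 / (\<Prod>i<k. a * of_real p powi (n + 1) * of_real p ^ i - b * of_real q powi (n + 1) * of_real q ^ i)"
    using assms(1) by (auto simp: pq_poch_def pq_poch_nat_def k_def)
  have "pq_poch (a, b) (p, q) n =
      1 / (\<Prod>i<Suc k. a * of_real p powi n * of_real p ^ i - b * of_real q powi n * of_real q ^ i)"
    using assms(1) k by (simp add: pq_poch_def pq_poch_nat_def)
  then show ?thesis
    unfolding rest prod.lessThan_Suc_shift pow[OF pq(1)] pow[OF pq(2)] by (simp add: mult.assoc)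
qed

text \<open>
  In a balanced quotient the powers of \<open>p\<close> cancel; the leading coefficients cancel when their products agree.
\<close>

lemma pq_poch_normalize:
  assumes "a \<noteq> 0" and "p \<noteq> 0"
  shows "pq_poch (a, b) (p, q) (int N)
    = a ^ N * (\<Prod>i<N. of_real p ^ i) * (\<Prod>i<N. 1 - b / a * of_real (q / p) ^ i)"
proof -
  have "a * of_real p ^ i - b * of_real q ^ i
      = a * of_real p ^ i * (1 - b / a * of_real (q / p) ^ i)" for i
    using assms by (simp add: field_simps)
  then show ?thesis
    by (simp add: pq_poch_of_nat prod.distrib)
qed

theorem mainTheorem5:
  fixes p q :: real and a b c d z :: complex
  assumes "0 < q" and "q < p"
    and "a \<noteq> 0" and "b \<noteq> 0" and "c \<noteq> 0" and "d \<noteq> 0" and "z \<noteq> 0"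
    and "\<And>i::nat. c * of_real p ^ i - d * of_real q ^ i \<noteq> 0"
    and "\<And>i::nat. of_real p * b * of_real p ^ i - of_real q * a * of_real q ^ i \<noteq> 0"
    and "\<And>i::nat. c * of_real p ^ i - a * z * of_real q ^ i \<noteq> 0"
    and "\<And>i::nat. of_real p * b * z * of_real p ^ i - of_real p * d * of_real q ^ i \<noteq> 0"
  shows "\<exists>R. has_pq_inf_quotient
        [(of_real p, of_real q), (b * c, a * d), (c, b * z), (of_real p * b * z, of_real q * c)]
        [(c, d), (of_real p * b, of_real q * a), (c, a * z), (of_real p * b * z, of_real p * d)]
        (p, q) R
      \<and> (norm (a * d / (b * c)) < norm z \<and> norm z < 1 \<and> psi11_converges (a, b) (c, d) (p, q) z
           \<longrightarrow> psi11 (a, b) (c, d) (p, q) z = R)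
      \<and> (norm (a * d / (b * c)) < norm (a * z / c) \<and> norm (a * z / c) < 1
           \<longrightarrow> psi11_converges (a, b) (c, d) (p, q) z \<and> psi11 (a, b) (c, d) (p, q) z = R)"
proof -
  note nz = \<open>a \<noteq> 0\<close> \<open>b \<noteq> 0\<close> \<open>c \<noteq> 0\<close> \<open>d \<noteq> 0\<close> \<open>z \<noteq> 0\<close>
  have p_nz: "p \<noteq> 0" and q_nz: "q \<noteq> 0" using assms(1,2) by auto
  define Q :: complex where "Q = of_real (q / p)"
  define A x Z where "A = b / a" and "x = d / c" and "Z = a * z / c"
  define u where "u = pq_poch (1, A) (1, q / p)"
  have Q0: "Q \<noteq> 0" and Q1: "norm Q < 1"
    using assms(1,2) by (simp_all add: Q_def norm_divide)
  have AZx0: "A \<noteq> 0" "Z \<noteq> 0" "x \<noteq> 0" using nz by (auto simp: A_def Z_def x_def)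
  have factor: "e * of_real p powi n - f * of_real q powi n
      = e * of_real p powi n * (1 - f / e * Q powi n)" if "e \<noteq> 0" for e f :: complex and n
    using that p_nz by (simp add: Q_def power_int_divide_distrib field_simps)
  have A_neg: "1 - A * Q powi n \<noteq> 0" if "n < 0" for n
  proof
    assume *: "1 - A * Q powi n = 0"
    define i where "i = nat (- n - 1)"
    have n: "n = - int (Suc i)"
      using that by (simp add: i_def)
    have "A = Q ^ Suc i"
      using * Q0 unfolding n power_int_minus power_int_of_nat by (simp add: field_simps)
    then have "b * of_real p ^ Suc i = a * of_real q ^ Suc i"
      using nz p_nz by (simp add: A_def Q_def field_simps)
    then show False using assms(9)[of i] by (simp add: mult_ac)
  qed
  interpret bilateral_factorial Q A u
  proof
    show "u (n + 1) = (1 - A * Q powi n) * u n" for n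
    proof (cases "n \<ge> 0")
      case True
      then show ?thesis by (simp add: u_def pq_poch_Suc Q_def)
    next
      case False
      then show ?thesis
        using pq_poch_pred[of n 1 "q / p" 1 A] A_neg[of n] p_nz q_nz
        by (simp add: u_def Q_def)
    qed
  qed (use Q0 Q1 AZx0 in \<open>simp_all add: u_def pq_poch_def pq_poch_nat_def\<close>)

  \<comment> \<open>Each assumption on the denominators says that one classical product has no vanishing factor.\<close>
  let ?P = "\<lambda>y N. \<Prod>i<N. 1 - y * Q ^ i"
  have B: "1 - x * Q ^ i \<noteq> 0" for i
    using assms(8)[of i] factor[of c "int i" d] nz p_nz by (auto simp: x_def)
  have C: "1 - Z * Q ^ i \<noteq> 0" for i
    using assms(10)[of i] factor[of c "int i" "a * z"] nz p_nz by (auto simp: Z_def)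
  have AZ: "A * Z = b * z / c" using nz by (simp add: A_def Z_def)
  have xAZ: "x / (A * Z) = d / (b * z)" using nz by (simp add: x_def AZ)
  have D: "1 - x / (A * Z) * Q ^ i \<noteq> 0" for i
    using assms(11)[of i] factor[of "of_real p * b * z" "int i" "of_real p * d"] nz p_nz
    by (auto simp: xAZ)
  note nonzero = qinf_nonzero[OF Q1 B] qinf_nonzero[OF Q1 nonresonant]
    qinf_nonzero[OF Q1 C] qinf_nonzero[OF Q1 D]
  define R where "R = (qinf Q Q * qinf (x / A) Q * qinf (A * Z) Q * qinf (Q / (A * Z)) Q)
    / (qinf x Q * qinf (Q / A) Q * qinf Z Q * qinf (x / (A * Z)) Q)"

  have "has_pq_inf_quotient
        [(of_real p, of_real q), (b * c, a * d), (c, b * z), (of_real p * b * z, of_real q * c)]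
        [(c, d), (of_real p * b, of_real q * a), (c, a * z), (of_real p * b * z, of_real p * d)]
        (p, q) R"
    unfolding has_pq_inf_quotient_def
  proof (rule Lim_transform_eventually)
    show "(\<lambda>N. (?P Q N * ?P (x / A) N * ?P (A * Z) N * ?P (Q / (A * Z)) N)
        / (?P x N * ?P (Q / A) N * ?P Z N * ?P (x / (A * Z)) N)) \<longlonglongrightarrow> R"
      unfolding R_def by (intro tendsto_intros qinf_LIMSEQ Q1) (use nonzero in auto)
    have ratios: "of_real q / of_real p = Q" "a * d / (b * c) = x / A" "b * z / c = A * Z"
      "of_real q * c / (of_real p * b * z) = Q / (A * Z)" "d / c = x"
      "of_real q * a / (of_real p * b) = Q / A" "a * z / c = Z"
      "of_real p * d / (of_real p * b * z) = x / (A * Z)"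
      using nz p_nz by (simp_all add: A_def x_def Z_def Q_def field_simps)
    have lead: "of_real p \<noteq> (0::complex)" "b * c \<noteq> 0" "of_real p * b * z \<noteq> 0" "of_real p * b \<noteq> 0"
      using nz p_nz by auto
    show "\<forall>\<^sub>F N in sequentially.
        (?P Q N * ?P (x / A) N * ?P (A * Z) N * ?P (Q / (A * Z)) N)
          / (?P x N * ?P (Q / A) N * ?P Z N * ?P (x / (A * Z)) N)
        = pq_poch_list [(of_real p, of_real q), (b * c, a * d), (c, b * z),
            (of_real p * b * z, of_real q * c)] (p, q) (int N)
          / pq_poch_list [(c, d), (of_real p * b, of_real q * a), (c, a * z),
            (of_real p * b * z, of_real p * d)] (p, q) (int N)"
    proof (intro always_eventually allI)
      fix N
      define w where "w = (\<Prod>i<N. of_real p ^ i :: complex)"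
      have w: "w \<noteq> 0" using p_nz by (simp add: w_def)
      have num: "pq_poch_list [(of_real p, of_real q), (b * c, a * d), (c, b * z),
            (of_real p * b * z, of_real q * c)] (p, q) (int N)
          = (of_real p ^ N * b ^ N * c ^ N * c ^ N * (of_real p * b * z) ^ N * w ^ 4)
            * (?P Q N * ?P (x / A) N * ?P (A * Z) N * ?P (Q / (A * Z)) N)"
        unfolding pq_poch_list_def list.map prod_list.Cons prod_list.Nil mult_1_right
            pq_poch_normalize[OF lead(1) p_nz] pq_poch_normalize[OF lead(2) p_nz]
            pq_poch_normalize[OF nz(3) p_nz] pq_poch_normalize[OF lead(3) p_nz]
            ratios Q_def[symmetric] w_def[symmetric]
        by (simp only: power_mult_distrib power4_eq_xxxx mult_ac)
      have den: "pq_poch_list [(c, d), (of_real p * b, of_real q * a), (c, a * z),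
            (of_real p * b * z, of_real p * d)] (p, q) (int N)
          = (of_real p ^ N * b ^ N * c ^ N * c ^ N * (of_real p * b * z) ^ N * w ^ 4)
            * (?P x N * ?P (Q / A) N * ?P Z N * ?P (x / (A * Z)) N)"
        unfolding pq_poch_list_def list.map prod_list.Cons prod_list.Nil mult_1_right
            pq_poch_normalize[OF lead(4) p_nz]
            pq_poch_normalize[OF nz(3) p_nz] pq_poch_normalize[OF lead(3) p_nz]
            ratios Q_def[symmetric] w_def[symmetric]
        by (simp only: power_mult_distrib power4_eq_xxxx mult_ac)
      have "of_real p ^ N * b ^ N * c ^ N * c ^ N * (of_real p * b * z) ^ N * w ^ 4 \<noteq> 0"
        using nz p_nz w by simp
      then show "(?P Q N * ?P (x / A) N * ?P (A * Z) N * ?P (Q / (A * Z)) N)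
          / (?P x N * ?P (Q / A) N * ?P Z N * ?P (x / (A * Z)) N)
        = pq_poch_list [(of_real p, of_real q), (b * c, a * d), (c, b * z),
            (of_real p * b * z, of_real q * c)] (p, q) (int N)
          / pq_poch_list [(c, d), (of_real p * b, of_real q * a), (c, a * z),
            (of_real p * b * z, of_real p * d)] (p, q) (int N)"
        unfolding num den by (rule mult_divide_mult_cancel_left[symmetric])
    qed
  qed

  moreover
  \<comment> \<open>Both sides satisfy the same first-order recurrence. Upwards from \<open>0\<close> it divides by \<open>1 - x Q\<^sup>n\<close>,
    downwards by \<open>1 - A Q\<^sup>n\<close>, and neither vanishes in its range. If \<open>1 - x Q\<^sup>n = 0\<close> for some
    \<open>n < 0\<close>, both sides are zero from there downwards.\<close>
  have term_eq: "reg_term Z x n = qinf x Q * psi11_term (a, b) (c, d) (p, q) z n" for n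
  proof -
    let ?\<psi> = "psi11_term (a, b) (c, d) (p, q) z"
    have reg_term_Suc: "(1 - x * Q powi n) * reg_term Z x (n + 1) = Z * (1 - A * Q powi n) * reg_term Z x n" for n
    proof -
      have 1: "qinf (x * Q powi n) Q = (1 - x * Q powi n) * qinf (x * Q powi (n + 1)) Q"
        using Q0 by (subst qinf_step[OF Q1]) (simp add: power_int_add mult_ac)
      have 2: "Z powi (n + 1) = Z powi n * Z"
        using AZx0 by (simp add: power_int_add)
      show ?thesis unfolding reg_term_def 1 2 u_Suc by (simp only: mult_ac)
    qed
    have ratio: "(a * of_real p powi n - b * of_real q powi n) * z
        / (c * of_real p powi n - d * of_real q powi n)
        = Z * (1 - A * Q powi n) / (1 - x * Q powi n)" for n
      unfolding factor[OF nz(1)] factor[OF nz(3)] using nz p_nz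
      by (simp add: A_def x_def Z_def)
    show ?thesis
    proof (induction n rule: int_induct[where k = 0])
      case base
      show ?case
        by (simp add: reg_term_def u_0 psi11_term_def pq_poch_def pq_poch_nat_def)
    next
      case (step1 n)
      have nz': "1 - x * Q powi n \<noteq> 0"
        using B[of "nat n"] step1(1) by (simp add: power_int_nonneg_exp)
      have "?\<psi> (n + 1) = ?\<psi> n * ((a * of_real p powi n - b * of_real q powi n) * z
          / (c * of_real p powi n - d * of_real q powi n))"
        using step1(1) nz by (simp add: psi11_term_def pq_poch_Suc power_int_add mult_ac)
      then have "qinf x Q * ?\<psi> (n + 1) = reg_term Z x n * (Z * (1 - A * Q powi n) / (1 - x * Q powi n))"
        unfolding ratio step1(2) by simp
      also have "\<dots> = reg_term Z x (n + 1)"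
        using reg_term_Suc[of n] nz' by (simp add: field_simps)
      finally show ?case ..
    next
      case (step2 m)
      define n where "n = m - 1"
      have n: "n < 0" "m = n + 1" using step2(1) by (auto simp: n_def)
      have "?\<psi> n = ?\<psi> (n + 1) / ((a * of_real p powi n - b * of_real q powi n) * z
          / (c * of_real p powi n - d * of_real q powi n))"
        using n(1) nz p_nz q_nz by (simp add: psi11_term_def pq_poch_pred power_int_add mult_ac)
      then have "qinf x Q * ?\<psi> n = reg_term Z x (n + 1) / (Z * (1 - A * Q powi n) / (1 - x * Q powi n))"
        unfolding ratio step2(2)[unfolded n(2)] by simp
      also have "\<dots> = reg_term Z x n"
        using reg_term_Suc[of n] A_neg[OF n(1)] AZx0 by (simp add: field_simps)
      finally show ?case unfolding n_def ..
    qed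
  qed

  have sum_eq: "psi11 (a, b) (c, d) (p, q) z = R" if "psi11_converges (a, b) (c, d) (p, q) z"
  proof -
    have "(psi11_term (a, b) (c, d) (p, q) z has_sum psi11 (a, b) (c, d) (p, q) z) UNIV"
      using that by (simp add: psi11_converges_def psi11_def)
    then have "(reg_term Z x has_sum qinf x Q * psi11 (a, b) (c, d) (p, q) z) UNIV"
      unfolding term_eq[abs_def] by (rule has_sum_cmult_right)
    from ramanujan_psi_sum[OF AZx0(2) this] show ?thesis
      using nonzero unfolding R_def by (simp add: eq_divide_eq mult_ac)
  qed

  moreover
  have "psi11_converges (a, b) (c, d) (p, q) z"
    if "norm (a * d / (b * c)) < norm (a * z / c)" "norm (a * z / c) < 1"
  proof -
    have "norm (x / A) < norm Z" "norm Z < 1"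
      using that nz by (simp_all add: x_def A_def Z_def mult.commute)
    then have "reg_term Z x summable_on UNIV"
      using AZx0 by (intro reg_term_summable geometric_summable)
        (simp_all add: norm_divide norm_mult divide_less_eq mult.commute)
    then show ?thesis
      using nonzero(1) unfolding psi11_converges_def term_eq[abs_def]
      by (simp add: summable_on_cmult_right')
  qed

  ultimately show ?thesis by blast
qed

end
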